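(* Let $\{b_i\}_{i=1}^\infty$ be a sequence in $B(l_2)$ such that $\mathrm{id}_{l_2}=\sum_{i=1}^\infty b_i^*b_i$ in the sense of weak convergence. Then there exist a projection $p\in B(l_2)$ and an element $u\in B(l_2)$ with $uu^*=p$ and $u^*u=\mathrm{id}_{l_2}$ (so that $p\sim\mathrm{id}_{l_2}$), and a sequence of partial isometries $\{v_i\}_{i=1}^\infty\subset B(l_2)$ such that: (i) $v_iv_i^*=\mathrm{id}_{l_2}$ for every $i$; the $v_i^*v_i$ are projections in $B(l_2)$ equivalent to $\mathrm{id}_{l_2}$; $(v_i^*v_i)\perp(v_k^*v_k)$ for all $i\neq k$; and $\sum_{i=1}^\infty v_i^*v_i=\mathrm{id}_{l_2}$; (ii) there are partial isometries $\{u_i\}_{i=1}^\infty\subset B(l_2)$ such that $b_i=u_i(v_iu)$ for every $i\in\mathbb N$, each $u_i$ connecting the left carrier projections of $v_iu$ and of $b_i$, i.e. $u_i^*u_i$ is the left carrier projection of $v_iu$ and $u_iu_i^*$ is the left carrier projection of $b_i$.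
   Context: $l_2$ is the separable infinite-dimensional complex Hilbert space of square-summable sequences and $B(l_2)$ is the algebra of bounded linear operators on it. Projections are self-adjoint idempotents, $\sim$ is Murray-von Neumann equivalence of projections in $B(l_2)$, and infinite sums of operators are understood in the weak operator sense. Two projections are orthogonal ($\perp$) if their product is zero. The left carrier projection of $b\in B(l_2)$ is the smallest projection $q$ with $qb=b$, i.e. the projection onto the closure of the range of $b$. *)

theory Defs
  imports "HOL-Analysis.Analysis"
begin

typedef l2 = "{x :: nat \<Rightarrow> complex. summable (\<lambda>n. (cmod (x n))\<^sup>2)}"
  by (rule exI[of _ "\<lambda>_. 0"]) simp

setup_lifting type_definition_l2

lemma summable_Rep_l2: "summable (\<lambda>n. (cmod (Rep_l2 x n))\<^sup>2)"
  using Rep_l2[of x] by simp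

lemma square_summable_add:
  fixes x y :: "nat \<Rightarrow> complex"
  assumes "summable (\<lambda>n. (cmod (x n))\<^sup>2)" "summable (\<lambda>n. (cmod (y n))\<^sup>2)"
  shows "summable (\<lambda>n. (cmod (x n + y n))\<^sup>2)"
proof (rule summable_comparison_test')
  show "summable (\<lambda>n. 2 * (cmod (x n))\<^sup>2 + 2 * (cmod (y n))\<^sup>2)"
    by (intro summable_add summable_mult assms)
  fix n :: nat
  have "(cmod (x n + y n))\<^sup>2 \<le> (cmod (x n) + cmod (y n))\<^sup>2"
    by (intro power_mono norm_triangle_ineq) simp
  also have "\<dots> \<le> 2 * (cmod (x n))\<^sup>2 + 2 * (cmod (y n))\<^sup>2"
    using sum_squares_bound[of "cmod (x n)" "cmod (y n)"] by (simp add: power2_sum)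
  finally show "norm ((cmod (x n + y n))\<^sup>2) \<le> 2 * (cmod (x n))\<^sup>2 + 2 * (cmod (y n))\<^sup>2"
    by simp
qed

lemma square_summable_mult:
  fixes x :: "nat \<Rightarrow> complex"
  assumes "summable (\<lambda>n. (cmod (x n))\<^sup>2)"
  shows "summable (\<lambda>n. (cmod (c * x n))\<^sup>2)"
  using summable_mult[OF assms, of "(cmod c)\<^sup>2"] by (simp add: norm_mult power_mult_distrib)

lift_definition cscale :: "complex \<Rightarrow> l2 \<Rightarrow> l2" is "\<lambda>c x n. c * x n"
  by (rule square_summable_mult)

definition cinner :: "l2 \<Rightarrow> l2 \<Rightarrow> complex"
  where "cinner x y = (\<Sum>n. Rep_l2 x n * cnj (Rep_l2 y n))"

lemma summable_cinner: "summable (\<lambda>n. Rep_l2 x n * cnj (Rep_l2 y n))"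
proof (rule summable_comparison_test')
  show "summable (\<lambda>n. (cmod (Rep_l2 x n))\<^sup>2 + (cmod (Rep_l2 y n))\<^sup>2)"
    by (intro summable_add summable_Rep_l2)
  fix n :: nat
  have "2 * (cmod (Rep_l2 x n) * cmod (Rep_l2 y n))
      \<le> (cmod (Rep_l2 x n))\<^sup>2 + (cmod (Rep_l2 y n))\<^sup>2"
    using sum_squares_bound[of "cmod (Rep_l2 x n)" "cmod (Rep_l2 y n)"] by simp
  moreover have "0 \<le> cmod (Rep_l2 x n) * cmod (Rep_l2 y n)" by simp
  ultimately show "norm (Rep_l2 x n * cnj (Rep_l2 y n))
      \<le> (cmod (Rep_l2 x n))\<^sup>2 + (cmod (Rep_l2 y n))\<^sup>2"
    unfolding norm_mult complex_mod_cnj by linarith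
qed

instantiation l2 :: real_vector
begin

lift_definition zero_l2 :: l2 is "\<lambda>_. 0" by simp

lift_definition plus_l2 :: "l2 \<Rightarrow> l2 \<Rightarrow> l2" is "\<lambda>x y n. x n + y n"
  by (rule square_summable_add)

lift_definition uminus_l2 :: "l2 \<Rightarrow> l2" is "\<lambda>x n. - x n" by simp

definition minus_l2 :: "l2 \<Rightarrow> l2 \<Rightarrow> l2" where "minus_l2 x y = x + (- y)"

definition scaleR_l2 :: "real \<Rightarrow> l2 \<Rightarrow> l2" where "scaleR_l2 r x = cscale (of_real r) x"

instance
proof
  fix x y z :: l2 and a b :: real
  show "x + y + z = x + (y + z)" by transfer (simp add: fun_eq_iff)
  show "x + y = y + x" by transfer (simp add: fun_eq_iff)
  show "0 + x = x" by transfer simp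
  show "- x + x = 0" by transfer simp
  show "x - y = x + - y" by (rule minus_l2_def)
  show "a *\<^sub>R (x + y) = a *\<^sub>R x + a *\<^sub>R y"
    unfolding scaleR_l2_def by transfer (simp add: fun_eq_iff algebra_simps)
  show "(a + b) *\<^sub>R x = a *\<^sub>R x + b *\<^sub>R x"
    unfolding scaleR_l2_def by transfer (simp add: fun_eq_iff algebra_simps)
  show "a *\<^sub>R b *\<^sub>R x = (a * b) *\<^sub>R x"
    unfolding scaleR_l2_def by transfer (simp add: fun_eq_iff)
  show "1 *\<^sub>R x = x" unfolding scaleR_l2_def by transfer simp
qed

end

instantiation l2 :: real_inner
begin

definition inner_l2 :: "l2 \<Rightarrow> l2 \<Rightarrow> real" where "inner_l2 x y = Re (cinner x y)"

definition norm_l2 :: "l2 \<Rightarrow> real" where "norm_l2 x = sqrt (\<Sum>n. (cmod (Rep_l2 x n))\<^sup>2)"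

definition dist_l2 :: "l2 \<Rightarrow> l2 \<Rightarrow> real" where "dist_l2 x y = norm (x - y)"

definition sgn_l2 :: "l2 \<Rightarrow> l2" where "sgn_l2 x = x /\<^sub>R norm x"

definition uniformity_l2 :: "(l2 \<times> l2) filter"
  where "uniformity_l2 = (INF e\<in>{0<..}. principal {(x, y). dist x y < e})"

definition open_l2 :: "l2 set \<Rightarrow> bool"
  where "open_l2 U \<longleftrightarrow> (\<forall>x\<in>U. eventually (\<lambda>(x', y). x' = x \<longrightarrow> y \<in> U) uniformity)"

instance
proof
  fix x y z :: l2 and r :: real and U :: "l2 set"
  show "dist x y = norm (x - y)" by (rule dist_l2_def)
  show "sgn x = x /\<^sub>R norm x" by (rule sgn_l2_def)
  show "uniformity = (INF e\<in>{0<..}. principal {(x :: l2, y). dist x y < e})"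
    by (rule uniformity_l2_def)
  show "open U \<longleftrightarrow> (\<forall>x\<in>U. eventually (\<lambda>(x', y). x' = x \<longrightarrow> y \<in> U) uniformity)"
    by (rule open_l2_def)
  have Re_eq: "inner v w = (\<Sum>n. Re (Rep_l2 v n * cnj (Rep_l2 w n)))" for v w
    unfolding inner_l2_def cinner_def by (rule Re_suminf[OF summable_cinner])
  have Re_sum: "summable (\<lambda>n. Re (Rep_l2 v n * cnj (Rep_l2 w n)))" for v w
    by (rule summable_Re[OF summable_cinner])
  show "inner x y = inner y x" unfolding Re_eq by (simp add: algebra_simps)
  show "inner (x + y) z = inner x z + inner y z"
    unfolding Re_eq by (subst suminf_add[OF Re_sum Re_sum]) (simp add: plus_l2.rep_eq algebra_simps)
  show "inner (r *\<^sub>R x) y = r * inner x y"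
    unfolding Re_eq
    by (subst suminf_mult[OF Re_sum, symmetric])
      (simp add: scaleR_l2_def cscale.rep_eq algebra_simps)
  have sq: "inner x x = (\<Sum>n. (cmod (Rep_l2 x n))\<^sup>2)"
    unfolding Re_eq cmod_power2 by (simp add: power2_eq_square)
  show "0 \<le> inner x x" unfolding sq by (intro suminf_nonneg summable_Rep_l2) simp
  have "(\<Sum>n. (cmod (Rep_l2 x n))\<^sup>2) = 0 \<longleftrightarrow> (\<forall>n. (cmod (Rep_l2 x n))\<^sup>2 = 0)"
    by (rule suminf_eq_zero_iff[OF summable_Rep_l2]) simp
  then show "inner x x = 0 \<longleftrightarrow> x = 0"
    unfolding sq by transfer (simp add: fun_eq_iff)
  show "norm x = sqrt (inner x x)" unfolding sq by (rule norm_l2_def)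
qed

end

lemma cinner_add_left: "cinner (x + y) z = cinner x z + cinner y z"
  unfolding cinner_def
  by (subst suminf_add[OF summable_cinner summable_cinner])
    (simp add: plus_l2.rep_eq algebra_simps)

lemma cinner_cscale_left: "cinner (cscale c x) y = c * cinner x y"
  unfolding cinner_def
  by (subst suminf_mult[OF summable_cinner, symmetric]) (simp add: cscale.rep_eq algebra_simps)

lemma cinner_commute: "cinner x y = cnj (cinner y x)"
proof -
  have "(\<lambda>n. cnj (Rep_l2 y n * cnj (Rep_l2 x n))) sums cnj (cinner y x)"
    unfolding sums_cnj cinner_def by (rule summable_sums[OF summable_cinner])
  then show ?thesis
    unfolding cinner_def[of x y] by (simp add: sums_iff mult.commute)
qed

lemma cinner_add_right: "cinner x (y + z) = cinner x y + cinner x z"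
  unfolding cinner_commute[of x] cinner_add_left by simp

lemma cinner_cscale_right: "cinner x (cscale c y) = cnj c * cinner x y"
  unfolding cinner_commute[of x] cinner_cscale_left by simp

lemma cinner_self: "cinner x x = of_real ((norm x)\<^sup>2)"
proof -
  have "Im (cinner x x) = 0" using arg_cong[OF cinner_commute[of x x], of Im] by simp
  moreover have "Re (cinner x x) = (norm x)\<^sup>2"
    using dot_square_norm[of x] by (simp add: inner_l2_def)
  ultimately show ?thesis by (simp add: complex_eq_iff)
qed

lemma norm_cscale: "norm (cscale c x) = cmod c * norm x"
proof -
  have "complex_of_real ((norm (cscale c x))\<^sup>2) = of_real ((cmod c)\<^sup>2 * (norm x)\<^sup>2)"
    unfolding cinner_self[symmetric] of_real_mult
    by (simp add: cinner_cscale_left cinner_cscale_right complex_norm_square del: of_real_power)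
  then have "(norm (cscale c x))\<^sup>2 = (cmod c * norm x)\<^sup>2"
    unfolding of_real_eq_iff by (simp add: power_mult_distrib)
  then show ?thesis by (simp add: power2_eq_iff_nonneg)
qed

lemma norm_cinner_le: "cmod (cinner x y) \<le> norm x * norm y"
proof -
  define c where "c = cnj (sgn (cinner x y))"
  have "cinner (cscale c x) y = of_real (cmod (cinner x y))"
    by (simp add: c_def cinner_cscale_left sgn_eq complex_norm_square[symmetric]
        mult.commute power2_eq_square)
  then have "cmod (cinner x y) = inner (cscale c x) y" by (simp add: inner_l2_def)
  also have "\<dots> \<le> norm (cscale c x) * norm y" by (rule norm_cauchy_schwarz)
  also have "\<dots> \<le> norm x * norm y"
    by (intro mult_right_mono) (simp_all add: norm_cscale c_def norm_sgn)
  finally show ?thesis .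
qed

lemma cinner_eqI:
  assumes "\<And>x. cinner x y = cinner x z"
  shows "y = z"
proof -
  have "inner x (y - z) = 0" for x
    unfolding inner_diff_right unfolding inner_l2_def by (simp add: assms)
  then have "inner (y - z) (y - z) = 0" by blast
  then show ?thesis by simp
qed

text \<open>The class structure of \<^typ>\<open>l2\<close> is over the reals, so \<^const>\<open>bounded_linear\<close> alone is only
  real linearity and boundedness.\<close>

definition B_l2 :: "(l2 \<Rightarrow> l2) set"
  where "B_l2 = {a. bounded_linear a \<and> (\<forall>c x. a (cscale c x) = cscale c (a x))}"

definition adj :: "(l2 \<Rightarrow> l2) \<Rightarrow> l2 \<Rightarrow> l2"
  where "adj a = (THE b. b \<in> B_l2 \<and> (\<forall>x y. cinner (a x) y = cinner x (b y)))"

lift_definition unit_l2 :: "nat \<Rightarrow> l2" is "\<lambda>n k. if k = n then 1 else 0"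
proof -
  fix n :: nat
  show "summable (\<lambda>k. (cmod (if k = n then 1 else 0))\<^sup>2)"
    by (rule summable_finite[of "{n}"]) auto
qed

lemma Rep_l2_sum_unit:
  "Rep_l2 (\<Sum>n<N. cscale (z n) (unit_l2 n)) k = (if k < N then z k else 0)"
  by (induction N) (auto simp: plus_l2.rep_eq zero_l2.rep_eq cscale.rep_eq unit_l2.rep_eq less_Suc_eq)

lemma norm_sum_unit: "(norm (\<Sum>n<N. cscale (z n) (unit_l2 n)))\<^sup>2 = (\<Sum>n<N. (cmod (z n))\<^sup>2)"
proof -
  let ?t = "\<Sum>n<N. cscale (z n) (unit_l2 n)"
  have "(norm ?t)\<^sup>2 = (\<Sum>n. (cmod (Rep_l2 ?t n))\<^sup>2)"
    unfolding norm_l2_def by (intro real_sqrt_pow2 suminf_nonneg summable_Rep_l2) simp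
  also have "\<dots> = (\<Sum>n<N. (cmod (Rep_l2 ?t n))\<^sup>2)"
    by (rule suminf_finite) (auto simp: Rep_l2_sum_unit)
  finally show ?thesis by (simp add: Rep_l2_sum_unit)
qed

lemma sum_unit_tendsto: "(\<lambda>N. \<Sum>n<N. cscale (Rep_l2 x n) (unit_l2 n)) \<longlonglongrightarrow> x"
proof -
  let ?t = "\<lambda>N. \<Sum>n<N. cscale (Rep_l2 x n) (unit_l2 n)"
  let ?f = "\<lambda>n. (cmod (Rep_l2 x n))\<^sup>2"
  have *: "norm (?t N - x) = sqrt (suminf ?f - (\<Sum>n<N. ?f n))" for N
  proof -
    have "(\<lambda>n. if n \<in> {..<N} then ?f n else 0) sums (\<Sum>n\<in>{..<N}. ?f n)"
      by (rule sums_If_finite_set) simp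
    then have "(\<lambda>n. ?f n - (if n \<in> {..<N} then ?f n else 0)) sums (suminf ?f - (\<Sum>n<N. ?f n))"
      by (intro sums_diff summable_sums summable_Rep_l2)
    moreover have "?f n - (if n \<in> {..<N} then ?f n else 0) = (cmod (Rep_l2 (?t N - x) n))\<^sup>2" for n
      unfolding minus_l2_def[of "?t N"] plus_l2.rep_eq uminus_l2.rep_eq Rep_l2_sum_unit by simp
    ultimately show ?thesis unfolding norm_l2_def by (simp add: sums_iff)
  qed
  have "(\<lambda>N. sqrt (suminf ?f - (\<Sum>n<N. ?f n))) \<longlonglongrightarrow> sqrt (suminf ?f - suminf ?f)"
    by (intro tendsto_intros summable_LIMSEQ summable_Rep_l2)
  then have "(\<lambda>N. norm (?t N - x)) \<longlonglongrightarrow> 0" unfolding * by simp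
  then show ?thesis using tendsto_norm_zero_iff LIM_zero_iff by blast
qed

lemma riesz_l2:
  assumes f: "bounded_linear f" and fc: "\<And>c x. f (cscale c x) = c * f x"
  shows "\<exists>z. \<forall>x. f x = cinner x z"
proof -
  interpret bounded_linear f by (rule f)
  obtain K where K: "0 < K" "\<And>x. cmod (f x) \<le> norm x * K" using pos_bounded by blast
  define z where "z = (\<lambda>n. cnj (f (unit_l2 n)))"
  have f_sum: "f (\<Sum>n<N. cscale (w n) (unit_l2 n)) = (\<Sum>n<N. w n * cnj (z n))" for w N
    by (simp add: sum fc z_def)
  have "(\<Sum>n<N. (cmod (z n))\<^sup>2) \<le> K\<^sup>2" for N
  proof -
    let ?t = "\<Sum>n<N. cscale (z n) (unit_l2 n)"
    have "of_real ((norm ?t)\<^sup>2) = f ?t"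
      unfolding f_sum norm_sum_unit by (simp only: of_real_sum complex_norm_square)
    then have "(norm ?t)\<^sup>2 = cmod (f ?t)" by (metis norm_of_real abs_of_nonneg zero_le_power2)
    also have "\<dots> \<le> norm ?t * K" by (rule K)
    finally have "norm ?t \<le> K"
      using K(1) by (cases "norm ?t = 0") (auto simp: power2_eq_square mult_le_cancel_left)
    then show ?thesis unfolding norm_sum_unit[symmetric] by (intro power_mono) auto
  qed
  then have "summable (\<lambda>n. (cmod (z n))\<^sup>2)"
    by (intro bounded_imp_summable[of _ "K\<^sup>2"])
      (simp_all add: lessThan_Suc_atMost[symmetric] del: sum.lessThan_Suc)
  then have z: "Rep_l2 (Abs_l2 z) = z" by (simp add: Abs_l2_inverse)
  have "f x = cinner x (Abs_l2 z)" for x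
  proof (rule LIMSEQ_unique)
    show "(\<lambda>N. f (\<Sum>n<N. cscale (Rep_l2 x n) (unit_l2 n))) \<longlonglongrightarrow> f x"
      by (rule tendsto[OF sum_unit_tendsto])
    show "(\<lambda>N. f (\<Sum>n<N. cscale (Rep_l2 x n) (unit_l2 n))) \<longlonglongrightarrow> cinner x (Abs_l2 z)"
      unfolding f_sum cinner_def using summable_LIMSEQ[OF summable_cinner[of x "Abs_l2 z"]]
      by (simp add: z)
  qed
  then show ?thesis by blast
qed

lemma adj_exists:
  assumes a: "a \<in> B_l2"
  shows "\<exists>b. b \<in> B_l2 \<and> (\<forall>x y. cinner (a x) y = cinner x (b y))"
proof -
  interpret bounded_linear a using a by (simp add: B_l2_def)
  have ac: "a (cscale c x) = cscale c (a x)" for c x using a by (simp add: B_l2_def)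
  obtain K where K: "0 < K" "\<And>x. norm (a x) \<le> norm x * K" using pos_bounded by blast
  have scaleR_eq: "r *\<^sub>R x = cscale (of_real r) x" for r and x :: l2 by (rule scaleR_l2_def)
  have bl: "bounded_linear (\<lambda>x. cinner (a x) y)" for y
  proof (rule bounded_linear_intro[of _ "K * norm y"])
    fix x x' :: l2 and r :: real
    show "cinner (a (x + x')) y = cinner (a x) y + cinner (a x') y"
      by (simp add: add cinner_add_left)
    show "cinner (a (r *\<^sub>R x)) y = r *\<^sub>R cinner (a x) y"
      unfolding scaleR_eq ac by (simp add: cinner_cscale_left scaleR_conv_of_real)
    have "cmod (cinner (a x) y) \<le> norm (a x) * norm y" by (rule norm_cinner_le)
    also have "\<dots> \<le> (norm x * K) * norm y" by (intro mult_right_mono K) simp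
    finally show "norm (cinner (a x) y) \<le> norm x * (K * norm y)" by (simp add: mult.assoc)
  qed
  have "\<exists>z. \<forall>x. cinner (a x) y = cinner x z" for y
    by (rule riesz_l2[OF bl]) (simp add: ac cinner_cscale_left)
  then obtain b where b: "\<And>x y. cinner (a x) y = cinner x (b y)" by metis
  have bc: "b (cscale c y) = cscale c (b y)" for c y
    by (rule cinner_eqI) (simp add: b[symmetric] cinner_cscale_right)
  have "bounded_linear b"
  proof (rule bounded_linear_intro[of _ K])
    fix y y' :: l2 and r :: real
    show "b (y + y') = b y + b y'"
      by (rule cinner_eqI) (simp add: b[symmetric] cinner_add_right)
    show "b (r *\<^sub>R y) = r *\<^sub>R b y" by (simp add: scaleR_eq bc)
    have "complex_of_real ((norm (b y))\<^sup>2) = cinner (a (b y)) y" by (simp only: cinner_self[symmetric] b)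
    then have "(norm (b y))\<^sup>2 = cmod (cinner (a (b y)) y)"
      by (metis norm_of_real abs_of_nonneg zero_le_power2)
    also have "\<dots> \<le> norm (a (b y)) * norm y" by (rule norm_cinner_le)
    also have "\<dots> \<le> (norm (b y) * K) * norm y" by (intro mult_right_mono K) simp
    finally show "norm (b y) \<le> norm y * K"
      using K(1) by (cases "norm (b y) = 0") (auto simp: power2_eq_square mult_le_cancel_left mult_ac)
  qed
  then show ?thesis using b bc unfolding B_l2_def by blast
qed

lemma adj:
  assumes "a \<in> B_l2"
  shows "adj a \<in> B_l2" and "cinner (a x) y = cinner x (adj a y)"
proof -
  have "\<exists>!b. b \<in> B_l2 \<and> (\<forall>x y. cinner (a x) y = cinner x (b y))"
    using adj_exists[OF assms]
  proof (elim ex_ex1I)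
    fix b b' assume "b \<in> B_l2 \<and> (\<forall>x y. cinner (a x) y = cinner x (b y))"
      and "b' \<in> B_l2 \<and> (\<forall>x y. cinner (a x) y = cinner x (b' y))"
    then show "b = b'" by (intro ext cinner_eqI) metis
  qed
  from theI'[OF this] show "adj a \<in> B_l2" and "cinner (a x) y = cinner x (adj a y)"
    unfolding adj_def by blast+
qed

text \<open>The product of operators is composition \<^term>\<open>a \<circ> b\<close> and the unit is \<^term>\<open>id\<close>.\<close>

definition projection :: "(l2 \<Rightarrow> l2) \<Rightarrow> bool"
  where "projection p \<longleftrightarrow> p \<in> B_l2 \<and> adj p = p \<and> p \<circ> p = p"

definition partial_isometry :: "(l2 \<Rightarrow> l2) \<Rightarrow> bool"
  where "partial_isometry v \<longleftrightarrow> v \<in> B_l2 \<and> projection (adj v \<circ> v)"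

definition mvn_equiv :: "(l2 \<Rightarrow> l2) \<Rightarrow> (l2 \<Rightarrow> l2) \<Rightarrow> bool"
  where "mvn_equiv p q \<longleftrightarrow> projection p \<and> projection q \<and>
    (\<exists>w\<in>B_l2. w \<circ> adj w = p \<and> adj w \<circ> w = q)"

definition proj_orthogonal :: "(l2 \<Rightarrow> l2) \<Rightarrow> (l2 \<Rightarrow> l2) \<Rightarrow> bool"
  where "proj_orthogonal p q \<longleftrightarrow> p \<circ> q = (\<lambda>_. 0)"

text \<open>The order of projections: \<^term>\<open>p \<circ> q = p\<close> says that the range of \<^term>\<open>p\<close> is
  contained in that of \<^term>\<open>q\<close>.\<close>

definition proj_le :: "(l2 \<Rightarrow> l2) \<Rightarrow> (l2 \<Rightarrow> l2) \<Rightarrow> bool"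
  where "proj_le p q \<longleftrightarrow> p \<circ> q = p"

text \<open>A relation rather than a function, so that asserting it includes the existence of the
  smallest projection.\<close>

definition left_carrier :: "(l2 \<Rightarrow> l2) \<Rightarrow> (l2 \<Rightarrow> l2) \<Rightarrow> bool"
  where "left_carrier b q \<longleftrightarrow> projection q \<and> q \<circ> b = b \<and>
    (\<forall>r. projection r \<and> r \<circ> b = b \<longrightarrow> proj_le q r)"

definition wot_tendsto :: "(nat \<Rightarrow> l2 \<Rightarrow> l2) \<Rightarrow> (l2 \<Rightarrow> l2) \<Rightarrow> bool"
  where "wot_tendsto a s \<longleftrightarrow> (\<forall>x y. (\<lambda>n. cinner (a n x) y) \<longlonglongrightarrow> cinner (s x) y)"

definition wot_sums :: "(nat \<Rightarrow> l2 \<Rightarrow> l2) \<Rightarrow> (l2 \<Rightarrow> l2) \<Rightarrow> bool"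
  where "wot_sums a s \<longleftrightarrow> wot_tendsto (\<lambda>n x. \<Sum>i<n. a i x) s"

end

theory Submission
  imports Defs
begin

text \<open>Identify \<open>l\<^sub>2\<close> with the Hilbert sum of countably many copies of itself by means of a bijection
  between \<open>\<nat> \<times> \<nat>\<close> and \<open>\<nat>\<close>, and let \<open>v\<^sub>i\<close> be the coisometry onto the \<open>i\<close>-th summand. The hypothesis
  says exactly that the column \<open>u\<close> with entries \<open>b\<^sub>i\<close> is an isometry, and \<open>v\<^sub>i u = b\<^sub>i\<close>. Hence the
  connecting partial isometry can be chosen to be the left carrier projection of \<open>b\<^sub>i\<close> itself.\<close>

subsection \<open>The Hilbert space and its operators\<close>

lemma scaleR_l2_eq_cscale: "r *\<^sub>R x = cscale (of_real r) x" for x :: l2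
  by (rule scaleR_l2_def)

lemma uminus_l2_eq_cscale: "- x = cscale (- 1) x"
  using scaleR_l2_eq_cscale[of "- 1" x] by simp

lemma cinner_uminus_left: "cinner (- x) y = - cinner x y"
  by (simp add: uminus_l2_eq_cscale cinner_cscale_left)

lemma cinner_uminus_right: "cinner x (- y) = - cinner x y"
  by (simp add: uminus_l2_eq_cscale cinner_cscale_right)

lemma cinner_diff_left: "cinner (x - y) z = cinner x z - cinner y z"
  unfolding diff_conv_add_uminus cinner_add_left cinner_uminus_left ..

lemma cinner_diff_right: "cinner x (y - z) = cinner x y - cinner x z"
  unfolding diff_conv_add_uminus cinner_add_right cinner_uminus_right ..

lemma cinner_zero_left: "cinner 0 y = 0"
  using cinner_diff_left[of 0 0 y] by simp

lemma cinner_zero_right: "cinner x 0 = 0"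
  using cinner_diff_right[of x 0 0] by simp

lemma cinner_sum_left: "cinner (\<Sum>i\<in>A. f i) y = (\<Sum>i\<in>A. cinner (f i) y)"
  by (induction A rule: infinite_finite_induct) (simp_all add: cinner_zero_left cinner_add_left)

lemma cinner_eqI_left: "(\<And>x. cinner y x = cinner z x) \<Longrightarrow> y = z"
  by (rule cinner_eqI) (metis cinner_commute)

lemma bounded_linear_cscale: "bounded_linear (cscale c)"
  by (rule bounded_linear_intro[of _ "cmod c"])
    (transfer, simp add: fun_eq_iff algebra_simps,
     simp add: scaleR_l2_eq_cscale, transfer, simp add: fun_eq_iff algebra_simps,
     simp add: norm_cscale)

section \<open>Bounded complex-linear operators, adjoints and projections\<close>

lemma B_l2I:
  assumes "\<And>x y. a (x + y) = a x + a y" "\<And>c x. a (cscale c x) = cscale c (a x)"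
    and "\<And>x. norm (a x) \<le> norm x * K"
  shows "a \<in> B_l2"
  unfolding B_l2_def
  using assms by (auto intro!: bounded_linear_intro[of _ K] simp: scaleR_l2_eq_cscale)

lemma B_l2D:
  assumes "a \<in> B_l2"
  shows "bounded_linear a" "a (cscale c x) = cscale c (a x)" "a (x + y) = a x + a y"
  using assms by (auto simp: B_l2_def linear_simps)

lemma id_in_B_l2: "id \<in> B_l2"
  by (rule B_l2I[of _ 1]) auto

lemma comp_in_B_l2: "a \<in> B_l2 \<Longrightarrow> b \<in> B_l2 \<Longrightarrow> a \<circ> b \<in> B_l2"
  by (auto simp: B_l2_def o_def intro: bounded_linear_compose)

text \<open>A vector is determined by its inner products, so any function satisfying the adjoint
  identity is the adjoint; \<open>b\<close> need not be shown linear or bounded beforehand.\<close>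

lemma adj_eqI:
  assumes "a \<in> B_l2" "\<And>x y. cinner (a x) y = cinner x (b y)"
  shows "adj a = b"
  by (intro ext cinner_eqI) (metis adj(2) assms)

lemma cinner_adj_left:
  assumes "a \<in> B_l2"
  shows "cinner (adj a x) y = cinner x (a y)"
  using adj(2)[OF assms] by (metis cinner_commute)

lemma adj_adj: "a \<in> B_l2 \<Longrightarrow> adj (adj a) = a"
  by (intro adj_eqI adj(1) cinner_adj_left)

lemma adj_comp:
  assumes "a \<in> B_l2" "b \<in> B_l2"
  shows "adj (a \<circ> b) = adj b \<circ> adj a"
  using assms by (intro adj_eqI comp_in_B_l2) (simp_all add: adj(2))

lemma adj_id: "adj id = id"
  by (intro adj_eqI id_in_B_l2) simp

lemma projection_id: "projection id"
  by (simp add: projection_def id_in_B_l2 adj_id)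

text \<open>The inner factor \<open>adj u \<circ> u\<close> cancels from the square. This serves
  both the column \<open>u\<close> and the isometries \<open>adj (slice i)\<close>.\<close>

lemma projection_range_of_isometry:
  assumes "u \<in> B_l2" "adj u \<circ> u = id"
  shows "projection (u \<circ> adj u)"
proof -
  have "(u \<circ> adj u) \<circ> (u \<circ> adj u) = u \<circ> (adj u \<circ> u) \<circ> adj u"
    by (simp add: o_assoc)
  then show ?thesis
    using assms by (simp add: projection_def comp_in_B_l2 adj(1) adj_comp adj_adj)
qed

lemma mvn_equiv_range_of_isometry:
  assumes "u \<in> B_l2" "adj u \<circ> u = id"
  shows "mvn_equiv (u \<circ> adj u) id"
  using assms projection_range_of_isometry[OF assms] projection_id by (auto simp: mvn_equiv_def)

subsection \<open>Completeness and orthogonal projections\<close>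

text \<open>By the Riesz representation theorem, the pointwise limit of the functionals represented by
  a Cauchy sequence is represented by a vector, which is the limit.\<close>

lemma Cauchy_l2_convergent:
  fixes X :: "nat \<Rightarrow> l2"
  assumes X: "Cauchy X"
  shows "convergent X"
proof -
  have diff: "cmod (cinner y (X m) - cinner y (X n)) \<le> norm y * norm (X m - X n)" for y m n
    using norm_cinner_le[of y "X m - X n"] by (simp add: cinner_diff_right)
  have "Cauchy (\<lambda>n. cinner y (X n))" for y
  proof (rule CauchyI)
    fix e :: real assume "0 < e"
    \<comment> \<open>The summand 1 keeps the denominator positive when
      \<open>y = 0\<close>.\<close>
    then have "0 < e / (norm y + 1)" by (simp add: add_nonneg_pos)
    then obtain M where M: "\<And>m n. m \<ge> M \<Longrightarrow> n \<ge> M \<Longrightarrow> norm (X m - X n) < e / (norm y + 1)"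
      using CauchyD[OF X] by blast
    have "cmod (cinner y (X m) - cinner y (X n)) < e" if "m \<ge> M" "n \<ge> M" for m n
    proof -
      have "cmod (cinner y (X m) - cinner y (X n)) \<le> (norm y + 1) * norm (X m - X n)"
        by (rule order_trans[OF diff]) (simp add: mult_right_mono)
      also have "\<dots> < e" using M[OF that] by (simp only: pos_less_divide_eq add_nonneg_pos norm_ge_zero zero_less_one mult.commute)
      finally show ?thesis .
    qed
    then show "\<exists>M. \<forall>m\<ge>M. \<forall>n\<ge>M. cmod (cinner y (X m) - cinner y (X n)) < e" by blast
  qed
  then have "\<exists>l. (\<lambda>n. cinner y (X n)) \<longlonglongrightarrow> l" for y
    by (simp add: Cauchy_convergent_iff convergent_def)
  then obtain f where f: "\<And>y. (\<lambda>n. cinner y (X n)) \<longlonglongrightarrow> f y" by metis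
  obtain K where K: "\<And>n. norm (X n) \<le> K"
    using Cauchy_Bseq[OF X] by (auto simp: Bseq_def)
  have fc: "f (cscale c y) = c * f y" for c y
    by (rule LIMSEQ_unique[OF f]) (auto simp: cinner_cscale_left intro!: tendsto_intros f)
  have "bounded_linear f"
  proof (rule bounded_linear_intro[of _ K])
    show "f (y + z) = f y + f z" for y z
      by (rule LIMSEQ_unique[OF f]) (auto simp: cinner_add_left intro!: tendsto_intros f)
    show "f (r *\<^sub>R y) = r *\<^sub>R f y" for r y
      by (simp add: scaleR_l2_eq_cscale fc scaleR_conv_of_real)
    show "norm (f y) \<le> norm y * K" for y
      by (rule LIMSEQ_le_const2[OF tendsto_norm[OF f]])
        (meson K norm_cinner_le mult_left_mono norm_ge_zero order_trans)
  qed
  from riesz_l2[OF this fc] obtain z where z: "\<And>y. f y = cinner y z" by blast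
  have "X \<longlonglongrightarrow> z"
  proof (rule LIMSEQ_I)
    fix e :: real assume "0 < e"
    then have "0 < e / 2" by simp
    then obtain M where M: "\<And>m n. m \<ge> M \<Longrightarrow> n \<ge> M \<Longrightarrow> norm (X m - X n) < e / 2"
      using CauchyD[OF X] by blast
    have "norm (X m - z) < e" if m: "m \<ge> M" for m
    proof -
      \<comment> \<open>Testing the uniform estimate against the error itself yields its squared
        norm. The limit over \<open>n\<close> preserves only a weak inequality, hence the bound
        \<open>e / 2\<close>.\<close>
      let ?y = "X m - z"
      have "(\<lambda>n. cmod (cinner ?y (X m) - cinner ?y (X n))) \<longlonglongrightarrow> cmod (cinner ?y (X m) - f ?y)"
        by (intro tendsto_intros f)
      then have "cmod (cinner ?y (X m) - f ?y) \<le> norm ?y * (e / 2)"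
      proof (rule LIMSEQ_le_const2)
        have "cmod (cinner ?y (X m) - cinner ?y (X n)) \<le> norm ?y * (e / 2)" if "n \<ge> M" for n
          by (rule order_trans[OF diff]) (intro mult_left_mono less_imp_le M m that norm_ge_zero)
        then show "\<exists>N. \<forall>n\<ge>N. cmod (cinner ?y (X m) - cinner ?y (X n)) \<le> norm ?y * (e / 2)"
          by blast
      qed
      moreover have "cinner ?y (X m) - f ?y = of_real ((norm ?y)\<^sup>2)"
        by (simp only: z cinner_diff_right[symmetric] cinner_self)
      ultimately have "(norm ?y)\<^sup>2 \<le> norm ?y * (e / 2)"
        by (simp add: norm_power)
      then have "norm ?y \<le> e / 2"
        using \<open>0 < e\<close> by (cases "norm ?y = 0") (auto simp: power2_eq_square mult_le_cancel_left)
      with \<open>0 < e\<close> show ?thesis by simp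
    qed
    then show "\<exists>no. \<forall>n\<ge>no. norm (X n - z) < e" by blast
  qed
  then show ?thesis by (rule convergentI)
qed

section \<open>Closest points and projections onto closed subspaces\<close>

text \<open>By the parallelogram law a minimizing sequence is Cauchy, since convexity keeps
  midpoints in \<open>S\<close>; its limit attains the distance.\<close>

lemma closest_point_exists_l2:
  fixes S :: "l2 set"
  assumes S: "convex S" "closed S" "S \<noteq> {}"
  shows "\<exists>s\<in>S. \<forall>t\<in>S. dist x s \<le> dist x t"
proof -
  define d where "d = infdist x S"
  have d: "0 \<le> d" "\<And>t. t \<in> S \<Longrightarrow> d \<le> norm (x - t)"
    unfolding d_def by (auto simp: infdist_nonneg dist_norm[symmetric] infdist_le)
  have "\<exists>s\<in>S. norm (x - s) < d + inverse (real (Suc n))" for n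
  proof -
    have "(INF a\<in>S. dist x a) < d + inverse (real (Suc n))"
      using S(3) by (simp add: d_def infdist_notempty)
    then show ?thesis
      using S(3) by (subst (asm) cINF_less_iff) (simp_all only: bdd_below_image_dist dist_norm simp_thms)
  qed
  then obtain s where s: "\<And>n. s n \<in> S" "\<And>n. norm (x - s n) < d + inverse (real (Suc n))" by metis
  have "(\<lambda>n. d + inverse (real (Suc n))) \<longlonglongrightarrow> d + 0"
    by (intro tendsto_intros LIMSEQ_inverse_real_of_nat)
  then have upper: "(\<lambda>n. d + inverse (real (Suc n))) \<longlonglongrightarrow> d" by simp
  have lim: "(\<lambda>n. norm (x - s n)) \<longlonglongrightarrow> d"
  proof (rule tendsto_sandwich[OF _ _ tendsto_const upper])
    show "\<forall>\<^sub>F n in sequentially. d \<le> norm (x - s n)" using d(2) s(1) by simp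
    show "\<forall>\<^sub>F n in sequentially. norm (x - s n) \<le> d + inverse (real (Suc n))"
      using s(2) by (intro always_eventually allI less_imp_le)
  qed
  have para: "(norm (s m - s n))\<^sup>2 \<le> 2 * (norm (x - s m))\<^sup>2 + 2 * (norm (x - s n))\<^sup>2 - 4 * d\<^sup>2" for m n
  proof -
    define h where "h = (1 / 2) *\<^sub>R s m + (1 / 2) *\<^sub>R s n"
    have "h \<in> S" unfolding h_def by (intro convexD S(1) s) auto
    then have "d\<^sup>2 \<le> (norm (x - h))\<^sup>2" by (intro power_mono d)
    moreover have "(norm (s m - s n))\<^sup>2 + 4 * (norm (x - h))\<^sup>2
        = 2 * (norm (x - s m))\<^sup>2 + 2 * (norm (x - s n))\<^sup>2"
      unfolding power2_norm_eq_inner h_def by (simp add: inner_simps inner_commute algebra_simps)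
    ultimately show ?thesis by simp
  qed
  have "Cauchy s"
  proof (rule CauchyI)
    fix e :: real assume e: "0 < e"
    have "(\<lambda>n. (norm (x - s n))\<^sup>2) \<longlonglongrightarrow> d\<^sup>2" by (intro tendsto_intros lim)
    \<comment> \<open>With this margin for both indices, the right-hand side of \<open>para\<close>
      is below \<open>e\<^sup>2\<close>.\<close>
    then have "\<forall>\<^sub>F n in sequentially. (norm (x - s n))\<^sup>2 < d\<^sup>2 + e\<^sup>2 / 4"
      by (rule order_tendstoD) (use e in simp)
    then obtain M where M: "\<And>n. n \<ge> M \<Longrightarrow> (norm (x - s n))\<^sup>2 < d\<^sup>2 + e\<^sup>2 / 4"
      by (auto simp: eventually_sequentially)
    have "norm (s m - s n) < e" if "m \<ge> M" "n \<ge> M" for m n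
    proof (rule power2_less_imp_less)
      show "(norm (s m - s n))\<^sup>2 < e\<^sup>2"
        using para[of m n] M[OF that(1)] M[OF that(2)] by simp
    qed (use e in simp)
    then show "\<exists>M. \<forall>m\<ge>M. \<forall>n\<ge>M. norm (s m - s n) < e" by blast
  qed
  from Cauchy_l2_convergent[OF this] obtain l where l: "s \<longlonglongrightarrow> l" by (auto simp: convergent_def)
  have "l \<in> S" using closed_sequentially[OF S(2) s(1) l] .
  moreover have "norm (x - l) = d"
    by (rule LIMSEQ_unique[OF tendsto_norm[OF tendsto_diff[OF tendsto_const l]] lim])
  ultimately show ?thesis using d by (auto simp: dist_norm)
qed

text \<open>The residual of a closest point is orthogonal to \<open>S\<close>. Only one point of
  \<open>S\<close> has such a residual, and this uniqueness makes the map \<open>q\<close>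
  linear.\<close>

lemma projection_onto_closed_subspace:
  fixes S :: "l2 set"
  assumes cl: "closed S" and zero: "0 \<in> S"
    and add: "\<And>x y. x \<in> S \<Longrightarrow> y \<in> S \<Longrightarrow> x + y \<in> S"
    and scale: "\<And>c x. x \<in> S \<Longrightarrow> cscale c x \<in> S"
  obtains q where "projection q" "\<And>x. q x \<in> S" "\<And>x. x \<in> S \<Longrightarrow> q x = x"
proof -
  have conv: "convex S" by (rule convexI) (auto simp: scaleR_l2_eq_cscale intro: add scale)
  have "\<exists>s\<in>S. \<forall>t\<in>S. cinner (x - s) t = 0" for x
  proof -
    obtain s where s: "s \<in> S" "\<forall>t\<in>S. dist x s \<le> dist x t"
      using closest_point_exists_l2[OF conv cl] zero by blast
    \<comment> \<open>The variational inequality at \<open>s\<close>, applied to the competitor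
      \<open>t + s\<close>.\<close>
    have le: "Re (cinner (x - s) t) \<le> 0" if "t \<in> S" for t
      using any_closest_point_dot[OF conv cl s(1) add[OF that s(1)] s(2)]
      by (simp add: inner_l2_def)
    \<comment> \<open>Replacing \<open>t\<close> by its multiples by -1 and by plus and minus the
      imaginary unit forces both real and imaginary part to vanish.\<close>
    have "cinner (x - s) t = 0" if t: "t \<in> S" for t
      using le[OF t] le[OF scale[OF t, of "- 1"]] le[OF scale[OF t, of \<i>]] le[OF scale[OF t, of "- \<i>"]]
      by (simp add: cinner_cscale_right complex_eq_iff)
    with s(1) show ?thesis by blast
  qed
  then obtain q where q: "\<And>x. q x \<in> S" "\<And>x t. t \<in> S \<Longrightarrow> cinner (x - q x) t = 0" by metis
  have uniq: "q x = s" if "s \<in> S" "\<And>t. t \<in> S \<Longrightarrow> cinner (x - s) t = 0" for x s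
  proof -
    \<comment> \<open>The vector \<open>s - q x\<close> is the difference of the two residuals and
      lies in \<open>S\<close>, so it is orthogonal to itself.\<close>
    have "s - q x \<in> S"
      unfolding diff_conv_add_uminus uminus_l2_eq_cscale by (intro add scale that q)
    then have "cinner (x - q x) (s - q x) - cinner (x - s) (s - q x) = 0"
      by (simp add: q that)
    then have "cinner (s - q x) (s - q x) = 0" by (simp add: cinner_diff_left[symmetric])
    then show ?thesis by (simp add: cinner_self)
  qed
  have eq: "cinner x t = cinner (q x) t" if "t \<in> S" for x t
    using q(2)[OF that, of x] by (simp add: cinner_diff_left)
  have fix_S: "q x = x" if "x \<in> S" for x
    using that by (intro uniq) (simp_all add: cinner_zero_left)
  have q_add: "q (x + y) = q x + q y" for x y
    by (rule uniq) (simp_all only: add q(1) cinner_diff_left cinner_add_left eq[symmetric] diff_self)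
  have q_scale: "q (cscale c x) = cscale c (q x)" for c x
    by (rule uniq) (simp_all only: scale q(1) cinner_diff_left cinner_cscale_left eq[symmetric] diff_self)
  have "norm (q x) \<le> norm x * 1" for x
  proof -
    have "complex_of_real ((norm (q x))\<^sup>2) = cinner x (q x)"
      unfolding cinner_self[symmetric] by (rule eq[OF q(1), symmetric])
    then have "(norm (q x))\<^sup>2 = cmod (cinner x (q x))"
      by (metis norm_of_real abs_of_nonneg zero_le_power2)
    also have "\<dots> \<le> norm x * norm (q x)" by (rule norm_cinner_le)
    finally show ?thesis
      by (cases "norm (q x) = 0") (auto simp: power2_eq_square mult_le_cancel_right)
  qed
  with q_add q_scale have B: "q \<in> B_l2" by (rule B_l2I)
  have "adj q = q"
  proof (rule adj_eqI[OF B])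
    fix x y
    have "cinner x (q y) = cinner (q x) (q y)" by (rule eq[OF q(1)])
    also have "\<dots> = cinner (q x) y"
      using eq[OF q(1), of y x] by (metis cinner_commute)
    finally show "cinner (q x) y = cinner x (q y)" ..
  qed
  then have "projection q" using B by (auto simp: projection_def fix_S q(1))
  then show thesis using that q(1) fix_S by blast
qed

section \<open>Left carrier projections\<close>

text \<open>The carrier is the projection onto the closure of the range. It is the smallest because
  the fixed points of any competitor \<open>r\<close> form a closed set containing the
  range.\<close>

lemma left_carrier_exists:
  assumes b: "b \<in> B_l2"
  obtains q where "left_carrier b q"
proof -
  let ?S = "closure (range b)"
  have add: "x + y \<in> ?S" if "x \<in> ?S" "y \<in> ?S" for x y
  proof -
    obtain f where f: "\<And>n. f n \<in> range b" "f \<longlonglongrightarrow> x"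
      using \<open>x \<in> ?S\<close> unfolding closure_sequential by blast
    obtain g where g: "\<And>n. g n \<in> range b" "g \<longlonglongrightarrow> y"
      using \<open>y \<in> ?S\<close> unfolding closure_sequential by blast
    have "f n + g n \<in> range b" for n
    proof -
      obtain v w where "f n = b v" "g n = b w" using f(1)[of n] g(1)[of n] by blast
      then have "f n + g n = b (v + w)" by (simp only: B_l2D(3)[OF b])
      then show ?thesis by blast
    qed
    then show ?thesis
      unfolding closure_sequential by (intro exI[of _ "\<lambda>n. f n + g n"] conjI allI tendsto_add f(2) g(2))
  qed
  have scale: "cscale c x \<in> ?S" if "x \<in> ?S" for c x
  proof -
    have "cscale c ` ?S \<subseteq> closure (cscale c ` range b)"
      by (intro closure_bounded_linear_image_subset bounded_linear_cscale)
    also have "\<dots> \<subseteq> ?S"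
      by (intro closure_mono) (auto simp: B_l2D(2)[OF b, symmetric])
    finally show ?thesis using that by blast
  qed
  have zero: "0 \<in> ?S"
  proof -
    have "b 0 = 0" using B_l2D(1)[OF b] by (rule bounded_linear.linear[THEN linear_0])
    then show ?thesis by (metis closure_subset rangeI subsetD)
  qed
  obtain q where q: "projection q" "\<And>x. q x \<in> ?S" "\<And>x. x \<in> ?S \<Longrightarrow> q x = x"
    using projection_onto_closed_subspace[OF closed_closure zero add scale] by blast
  have qB: "q \<in> B_l2" and q_adj: "adj q = q" using q(1) by (auto simp: projection_def)
  have "q \<circ> b = b" using q(3) by (auto simp: closure_subset[THEN subsetD])
  moreover have "q \<circ> r = q" if r: "projection r" "r \<circ> b = b" for r
  proof -
    have rB: "r \<in> B_l2" and r_adj: "adj r = r" using r(1) by (auto simp: projection_def)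
    have "r x = x" if "x \<in> ?S" for x
    proof -
      have "closed {x. r x = x}"
        by (intro closed_Collect_eq continuous_on_id linear_continuous_on B_l2D(1)[OF rB])
      moreover have "range b \<subseteq> {x. r x = x}" using r(2) by (auto simp: fun_eq_iff)
      ultimately show ?thesis using that closure_minimal by blast
    qed
    then have "r \<circ> q = q" using q(2) by auto
    \<comment> \<open>Taking adjoints reverses the product and gives \<open>q \<circ> r = q\<close>,
      the form that \<open>proj_le\<close> requires.\<close>
    then have "adj (r \<circ> q) = adj q" by simp
    then show ?thesis using q_adj r_adj qB rB by (simp add: adj_comp)
  qed
  ultimately have "left_carrier b q" using q(1) by (simp add: left_carrier_def proj_le_def)
  then show thesis by (rule that)
qed

subsection \<open>Splitting the space into countably many copies of itself\<close>

text \<open>The pairing function arranges the coordinates in an infinite matrix, of which this is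
  row \<open>i\<close>. These maps become the coisometries \<open>v i\<close> of the
  theorem.\<close>

lift_definition slice :: "nat \<Rightarrow> l2 \<Rightarrow> l2" is "\<lambda>i x m. x (prod_encode (i, m))"
proof -
  fix i and x :: "nat \<Rightarrow> complex" assume x: "summable (\<lambda>n. (cmod (x n))\<^sup>2)"
  have "inj (\<lambda>m. prod_encode (i, m))" by (rule injI) simp
  from summable_reindex[OF x this] show "summable (\<lambda>m. (cmod (x (prod_encode (i, m))))\<^sup>2)"
    by (simp add: o_def)
qed

text \<open>Assembles rows into one vector. \<open>Abs_l2\<close> makes it total, but the value is
  meaningful only when the glued function is square summable.\<close>

definition join :: "(nat \<Rightarrow> l2) \<Rightarrow> l2"
  where "join z = Abs_l2 (\<lambda>n. Rep_l2 (z (fst (prod_decode n))) (snd (prod_decode n)))"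

lemma slice_add: "slice i (x + y) = slice i x + slice i y"
  by transfer simp

lemma slice_cscale: "slice i (cscale c x) = cscale c (slice i x)"
  by transfer simp

lemma slices_eqI:
  assumes "\<And>i. slice i x = slice i y"
  shows "x = y"
proof -
  have "Rep_l2 x n = Rep_l2 y n" for n
    using arg_cong[OF assms[of "fst (prod_decode n)"], of "\<lambda>z. Rep_l2 z (snd (prod_decode n))"]
    by (simp add: slice.rep_eq)
  then show ?thesis by (simp add: Rep_l2_inject[symmetric] fun_eq_iff)
qed

lemma norm_l2_sums: "(\<lambda>n. (cmod (Rep_l2 x n))\<^sup>2) sums (norm x)\<^sup>2"
  unfolding norm_l2_def
  by (simp add: suminf_nonneg summable_Rep_l2 summable_sums)

text \<open>What needs proof is that the glued function is square summable: its partial sums are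
  dominated by sums over finite squares of the matrix, hence by the sum of the squared row
  norms.\<close>

lemma slice_join:
  assumes z: "summable (\<lambda>i. (norm (z i))\<^sup>2)"
  shows "slice i (join z) = z i"
proof -
  let ?f = "\<lambda>n. Rep_l2 (z (fst (prod_decode n))) (snd (prod_decode n))"
  have "summable (\<lambda>n. (cmod (?f n))\<^sup>2)"
  proof (rule bounded_imp_summable)
    fix n
    have "(\<Sum>k\<le>n. (cmod (?f k))\<^sup>2) = (\<Sum>(i, m)\<in>prod_decode ` {..n}. (cmod (Rep_l2 (z i) m))\<^sup>2)"
      by (subst sum.reindex) (auto simp: inj_prod_decode case_prod_unfold)
    also have "\<dots> \<le> (\<Sum>(i, m)\<in>{..n} \<times> {..n}. (cmod (Rep_l2 (z i) m))\<^sup>2)"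
    proof (rule sum_mono2)
      \<comment> \<open>Neither component of a pair exceeds its code.\<close>
      show "prod_decode ` {..n} \<subseteq> {..n} \<times> {..n}"
      proof (rule subsetI, elim imageE)
        fix k p assume k: "k \<in> {..n}" and p: "p = prod_decode k"
        have "fst p \<le> k" "snd p \<le> k"
          using le_prod_encode_1[of "fst p" "snd p"] le_prod_encode_2[of "snd p" "fst p"] by (simp_all add: p)
        with k show "p \<in> {..n} \<times> {..n}" by (simp add: mem_Times_iff)
      qed
    qed auto
    also have "\<dots> = (\<Sum>i\<le>n. \<Sum>m\<le>n. (cmod (Rep_l2 (z i) m))\<^sup>2)"
      by (simp add: sum.cartesian_product)
    also have "\<dots> \<le> (\<Sum>i\<le>n. (norm (z i))\<^sup>2)"
    proof (rule sum_mono)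
      fix i
      have "(\<Sum>m\<le>n. (cmod (Rep_l2 (z i) m))\<^sup>2) \<le> (\<Sum>m. (cmod (Rep_l2 (z i) m))\<^sup>2)"
        by (intro sum_le_suminf summable_Rep_l2) auto
      then show "(\<Sum>m\<le>n. (cmod (Rep_l2 (z i) m))\<^sup>2) \<le> (norm (z i))\<^sup>2"
        using norm_l2_sums[of "z i"] by (simp add: sums_iff)
    qed
    also have "\<dots> \<le> (\<Sum>i. (norm (z i))\<^sup>2)" by (intro sum_le_suminf z) auto
    finally show "(\<Sum>k\<le>n. (cmod (?f k))\<^sup>2) \<le> (\<Sum>i. (norm (z i))\<^sup>2)" .
  qed simp
  then have "Rep_l2 (join z) = ?f" unfolding join_def by (intro Abs_l2_inverse) simp
  then show ?thesis by (simp add: Rep_l2_inject[symmetric] slice.rep_eq fun_eq_iff)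
qed

text \<open>The coordinate series converges absolutely, so it may be reindexed by pairs and summed
  row by row.\<close>

lemma cinner_slices_sums: "(\<lambda>i. cinner (slice i x) (slice i y)) sums cinner x y"
proof (rule has_sum_imp_sums, rule has_sum_SigmaD)
  have has_sum: "((\<lambda>n. Rep_l2 x n * cnj (Rep_l2 y n)) has_sum cinner x y) UNIV" for x y
  proof (rule norm_summable_imp_has_sum)
    show "summable (\<lambda>n. norm (Rep_l2 x n * cnj (Rep_l2 y n)))"
    proof (rule summable_comparison_test')
      show "summable (\<lambda>n. (cmod (Rep_l2 x n))\<^sup>2 + (cmod (Rep_l2 y n))\<^sup>2)"
        by (intro summable_add summable_Rep_l2)
      show "norm (norm (Rep_l2 x n * cnj (Rep_l2 y n)))
          \<le> (cmod (Rep_l2 x n))\<^sup>2 + (cmod (Rep_l2 y n))\<^sup>2" for n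
        using sum_squares_bound[of "cmod (Rep_l2 x n)" "cmod (Rep_l2 y n)"]
          mult_nonneg_nonneg[of "cmod (Rep_l2 x n)" "cmod (Rep_l2 y n)"]
        by (simp add: norm_mult del: mult_nonneg_nonneg)
    qed
    show "(\<lambda>n. Rep_l2 x n * cnj (Rep_l2 y n)) sums cinner x y"
      unfolding cinner_def by (rule summable_sums[OF summable_cinner])
  qed
  show "((\<lambda>k. Rep_l2 x (prod_encode k) * cnj (Rep_l2 y (prod_encode k))) has_sum cinner x y)
      (UNIV \<times> UNIV)"
    using has_sum[of x y] unfolding UNIV_Times_UNIV
    by (simp only: has_sum_reindex_bij_betw[OF bij_prod_encode, of "\<lambda>n. Rep_l2 x n * cnj (Rep_l2 y n)"])
  show "((\<lambda>m. Rep_l2 x (prod_encode (i, m)) * cnj (Rep_l2 y (prod_encode (i, m)))) has_sum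
      cinner (slice i x) (slice i y)) UNIV" for i
    using has_sum[of "slice i x" "slice i y"] by (simp add: slice.rep_eq)
qed

lemma norm_slices_sums: "(\<lambda>i. (norm (slice i x))\<^sup>2) sums (norm x)\<^sup>2"
  using cinner_slices_sums[of x x] unfolding cinner_self by (simp only: sums_of_real_iff)

lemma slice_in_B_l2: "slice i \<in> B_l2"
proof (rule B_l2I[of _ 1])
  fix x
  have "(norm (slice i x))\<^sup>2 = (\<Sum>k\<in>{i}. (norm (slice k x))\<^sup>2)" by simp
  also have "\<dots> \<le> (\<Sum>k. (norm (slice k x))\<^sup>2)"
    by (rule sum_le_suminf) (use norm_slices_sums[of x] in \<open>auto simp: sums_iff\<close>)
  also have "\<dots> = (norm x)\<^sup>2" using norm_slices_sums[of x] by (simp add: sums_iff)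
  finally show "norm (slice i x) \<le> norm x * 1" by (simp add: power2_le_iff_abs_le)
qed (simp_all add: slice_add slice_cscale)

text \<open>The adjoint places \<open>y\<close> in row \<open>i\<close> and zeros elsewhere. The
  case \<open>k = i\<close> gives the coisometry property, the other case orthogonality.\<close>

lemma slice_adj_slice: "slice k (adj (slice i) y) = (if k = i then y else 0)"
proof -
  have sl: "slice k (join (\<lambda>j. if j = i then y else 0)) = (if k = i then y else 0)" for k y
    by (rule slice_join, rule summable_finite[of "{i}"]) auto
  have "adj (slice i) = (\<lambda>y. join (\<lambda>j. if j = i then y else 0))"
  proof (rule adj_eqI[OF slice_in_B_l2])
    fix x y
    let ?z = "join (\<lambda>j. if j = i then y else 0)"
    have "(\<lambda>j. cinner (slice j x) (slice j ?z)) sums (\<Sum>j\<in>{i}. cinner (slice j x) (slice j ?z))"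
      by (rule sums_finite) (auto simp: sl cinner_zero_right)
    then have "(\<lambda>j. cinner (slice j x) (slice j ?z)) sums cinner (slice i x) y"
      by (simp add: sl)
    then show "cinner (slice i x) y = cinner x ?z"
      by (rule sums_unique2[OF _ cinner_slices_sums])
  qed
  then show ?thesis by (simp add: sl)
qed

section \<open>The isometry assembled from the given operators\<close>

text \<open>Tested on vectors, the weak sum says that the inner products of \<open>b i x\<close> and
  \<open>b i y\<close> add up to that of \<open>x\<close> and \<open>y\<close>. So the rows
  \<open>b i x\<close> can be joined, and joining them preserves inner products.\<close>

lemma isometric_column_exists:
  assumes b: "\<And>i. b i \<in> B_l2" and sum: "wot_sums (\<lambda>i. adj (b i) \<circ> b i) id"
  obtains u where "u \<in> B_l2" "adj u \<circ> u = id" "\<And>i. slice i \<circ> u = b i"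
proof -
  have sums: "(\<lambda>i. cinner (b i x) (b i y)) sums cinner x y" for x y
    using sum unfolding wot_sums_def wot_tendsto_def sums_def
    by (simp add: cinner_sum_left cinner_adj_left[OF b])
  have norm_sums: "(\<lambda>i. (norm (b i x))\<^sup>2) sums (norm x)\<^sup>2" for x
    using sums[of x x] unfolding cinner_self by (simp only: sums_of_real_iff)
  define u where "u x = join (\<lambda>i. b i x)" for x
  have slice_u: "slice i (u x) = b i x" for i x
    unfolding u_def by (rule slice_join) (use norm_sums in \<open>auto simp: sums_iff\<close>)
  have isom: "cinner (u x) (u y) = cinner x y" for x y
    using cinner_slices_sums[of "u x" "u y"] sums[of x y] by (simp add: slice_u sums_iff)
  have B: "u \<in> B_l2"
  proof (rule B_l2I[of _ 1])
    \<comment> \<open>Linearity is checked row by row, where it reduces to that of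
      \<open>slice i\<close> and \<open>b i\<close>.\<close>
    show "u (x + y) = u x + u y" for x y
      by (rule slices_eqI) (simp add: slice_u slice_add B_l2D(3)[OF b])
    show "u (cscale c x) = cscale c (u x)" for c x
      by (rule slices_eqI) (simp add: slice_u slice_cscale B_l2D(2)[OF b])
    show "norm (u x) \<le> norm x * 1" for x
      using norm_slices_sums[of "u x"] norm_sums[of x] by (simp add: slice_u sums_iff)
  qed
  have "adj u \<circ> u = id"
    by (intro ext cinner_eqI_left) (simp add: cinner_adj_left[OF B] isom)
  with B show thesis by (rule that) (simp add: slice_u fun_eq_iff)
qed

theorem proposition4p1:
  fixes b :: "nat \<Rightarrow> l2 \<Rightarrow> l2"
  assumes "\<And>i. b i \<in> B_l2"
    and "wot_sums (\<lambda>i. adj (b i) \<circ> b i) id"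
  shows "\<exists>p u. \<exists>v :: nat \<Rightarrow> l2 \<Rightarrow> l2.
    projection p \<and> u \<in> B_l2 \<and> u \<circ> adj u = p \<and> adj u \<circ> u = id \<and> mvn_equiv p id \<and>
    (\<forall>i. partial_isometry (v i)) \<and>
    (\<forall>i. v i \<circ> adj (v i) = id) \<and>
    (\<forall>i. projection (adj (v i) \<circ> v i) \<and> mvn_equiv (adj (v i) \<circ> v i) id) \<and>
    (\<forall>i k. i \<noteq> k \<longrightarrow> proj_orthogonal (adj (v i) \<circ> v i) (adj (v k) \<circ> v k)) \<and>
    wot_sums (\<lambda>i. adj (v i) \<circ> v i) id \<and>
    (\<exists>w :: nat \<Rightarrow> l2 \<Rightarrow> l2. \<forall>i.
      partial_isometry (w i) \<and> b i = w i \<circ> (v i \<circ> u) \<and>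
      left_carrier (v i \<circ> u) (adj (w i) \<circ> w i) \<and>
      left_carrier (b i) (w i \<circ> adj (w i)))"
proof -
  obtain u where u: "u \<in> B_l2" "adj u \<circ> u = id" "\<And>i. slice i \<circ> u = b i"
    by (rule isometric_column_exists[OF assms]) blast
  have "\<exists>q. left_carrier (b i) q" for i
    using left_carrier_exists[OF assms(1)] by blast
  \<comment> \<open>Since \<open>slice i \<circ> u\<close> equals \<open>b i\<close>, the initial
    and final projections must coincide, and a projection \<open>w i\<close> serves as its own
    connecting partial isometry.\<close>
  then obtain w where w: "\<And>i. left_carrier (b i) (w i)" by metis
  then have proj_w: "projection (w i)" and w_b: "w i \<circ> b i = b i" for i
    by (auto simp: left_carrier_def)
  then have w_idem: "w i \<circ> w i = w i" "adj (w i) = w i" "w i \<in> B_l2" for i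
    by (auto simp: projection_def)
  have coisom: "slice i \<circ> adj (slice i) = id" for i
    by (simp add: fun_eq_iff slice_adj_slice)
  have adj_coisom: "adj (slice i) \<in> B_l2" "adj (adj (slice i)) = slice i" for i
    by (simp_all add: adj(1) adj_adj slice_in_B_l2)
  \<comment> \<open>By \<open>coisom\<close> the adjoint \<open>adj (slice i)\<close> is an
    isometry, so the facts about ranges of isometries apply to it.\<close>
  have proj: "projection (adj (slice i) \<circ> slice i)" for i
    using projection_range_of_isometry[of "adj (slice i)"] by (simp add: adj_coisom coisom)
  have mvn: "mvn_equiv (adj (slice i) \<circ> slice i) id" for i
    using mvn_equiv_range_of_isometry[of "adj (slice i)"] by (simp add: adj_coisom coisom)
  have orth: "proj_orthogonal (adj (slice i) \<circ> slice i) (adj (slice k) \<circ> slice k)"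
    if "i \<noteq> k" for i k
    using that linear_0[OF bounded_linear.linear[OF B_l2D(1)[OF adj_coisom(1)]]]
    by (simp add: proj_orthogonal_def fun_eq_iff slice_adj_slice)
  \<comment> \<open>Moving the adjoint to the other side turns the weak sum into the row
    decomposition of the inner product.\<close>
  have sum: "wot_sums (\<lambda>i. adj (slice i) \<circ> slice i) id"
    using cinner_slices_sums unfolding wot_sums_def wot_tendsto_def sums_def
    by (simp add: cinner_sum_left cinner_adj_left[OF slice_in_B_l2])
  have "\<forall>i. partial_isometry (w i) \<and> b i = w i \<circ> (slice i \<circ> u) \<and>
      left_carrier (slice i \<circ> u) (adj (w i) \<circ> w i) \<and> left_carrier (b i) (w i \<circ> adj (w i))"
    by (simp add: u(3) w w_b w_idem proj_w partial_isometry_def)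
  moreover have "\<forall>i. partial_isometry (slice i)"
    by (simp add: partial_isometry_def slice_in_B_l2 proj)
  ultimately show ?thesis
    using u projection_range_of_isometry[OF u(1,2)] mvn_equiv_range_of_isometry[OF u(1,2)]
      coisom proj mvn orth sum
    by (intro exI[of _ "u \<circ> adj u"] exI[of _ u] exI[of _ slice] conjI exI[of _ w]) auto
qed

end
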